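(* Let $m,k\in\mathbb{N}$ and $a\in\mathbb{C}\setminus\{-1,-2,\ldots\}$. Then $$\sum_{n=1}^\infty\frac{H_n^{(m)}}{(n+a)(n+a+k)}=\frac1k\left\{\begin{aligned}&\sum_{n=1}^\infty\frac{1}{n^m(n+a)}+\sum_{j=1}^{m-1}(-1)^{j-1}\zeta(m+1-j)H_{k-1}^{(j)}(a)\\&+(-1)^{m-1}H_aH_{k-1}^{(m)}(a)+(-1)^{m-1}\sum_{i=1}^{k-1}\frac{H_i^{(1)}(a)}{(i+a)^m}\end{aligned}\right\}.$$ Moreover, when $a\in\mathbb{C}\setminus\{0,-1,-2,\ldots\}$, $$\int_0^1 x^{a-1}\mathrm{Li}_m(x)\,dx=\sum_{n=1}^\infty\frac{1}{n^m(n+a)}=\sum_{l=1}^{m-1}(-1)^{l-1}\frac{\zeta(m+1-l)}{a^l}+(-1)^{m-1}\frac{H_a}{a^m}.$$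
   Context: $\mathbb{N}=\{1,2,3,\ldots\}$. For $n\in\mathbb{N}$, $H_n^{(m)}=\sum_{j=1}^n j^{-m}$. For $\alpha\in\mathbb{C}\setminus\{-1,-2,\ldots\}$, $H_\alpha=\psi(\alpha+1)+\gamma=\sum_{l=1}^\infty\left(\frac1l-\frac1{l+\alpha}\right)$ is the shifted harmonic number ($\psi$ the digamma function, $\gamma$ the Euler–Mascheroni constant). The parametric harmonic numbers are $H_n^{(s)}(c)=\sum_{j=1}^n (j+c)^{-s}$ for integers $n\ge 0$ and $c\in\mathbb{C}\setminus\{-1,-2,\ldots\}$, so $H_0^{(s)}(c)=0$. $\zeta$ is the Riemann zeta function, and $\mathrm{Li}_m(x)=\sum_{n=1}^\infty x^n/n^m$ for $-1\le x<1$ is the polylogarithm, with $\mathrm{Li}_1(x)=-\ln(1-x)$. Empty sums are $0$.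
   Formalization: The identity between the integral and the series is stated only for Re a > -1, because for Re a ≤ -1 (e.g. a = -3/2) the integral diverges at 0; it is also proved that the integrand is integrable exactly when Re a > -1. *)

theory Defs
  imports "HOL-Analysis.Analysis"
begin

text \<open>
  The index set \<open>{1, 2, 3, \<dots>}\<close> of an infinite series is rendered by running over \<^term>\<open>Suc n\<close>.
\<close>

definition gen_harm :: "nat \<Rightarrow> nat \<Rightarrow> complex" where
  "gen_harm m n = (\<Sum>j=1..n. 1 / of_nat j ^ m)"

definition shifted_harm :: "complex \<Rightarrow> complex" where
  "shifted_harm \<alpha> = Digamma (\<alpha> + 1) + euler_mascheroni"

definition param_harm :: "nat \<Rightarrow> nat \<Rightarrow> complex \<Rightarrow> complex" where
  "param_harm s n c = (\<Sum>j=1..n. 1 / (of_nat j + c) ^ s)"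

text \<open>
  The Dirichlet series represents the Riemann zeta function only on the half-plane
  \<open>Re s > 1\<close>; no analytic continuation is built in, so \<open>zeta s\<close> is meaningful only there.
\<close>

definition zeta :: "complex \<Rightarrow> complex" where
  "zeta s = (\<Sum>n. 1 / of_nat (Suc n) powr s)"

text \<open>Meaningful for \<open>-1 \<le> x < 1\<close>, and also at \<open>x = 1\<close> when \<open>m \<ge> 2\<close>.\<close>

definition polylog :: "nat \<Rightarrow> real \<Rightarrow> real" where
  "polylog m x = (\<Sum>n. x ^ Suc n / of_nat (Suc n) ^ m)"

end

theory Submission
  imports Defs
begin

text \<open>
  Everything reduces to the pole series \<open>T\<^sub>m(b) = \<Sum>\<^sub>n 1 / (n\<^sup>m (n + b))\<close>.

  By partial fractions, \<open>k / ((n + a) (n + a + k)) = 1 / (n + a) - 1 / (n + a + k)\<close> splits into the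
  \<open>k\<close> unit steps \<open>1 / (n + b) - 1 / (n + b + 1)\<close> with \<open>b = a, a + 1, \<dots>, a + k - 1\<close>. Summation by
  parts moves the difference of each step onto the harmonic numbers \<open>H\<^sub>n\<^sup>(\<^sup>m\<^sup>)\<close>, whose increments
  are \<open>1 / n\<^sup>m\<close>; the boundary term vanishes since \<open>H\<^sub>n\<^sup>(\<^sup>m\<^sup>) = o(n)\<close>. Hence each step contributes
  \<open>T\<^sub>m(b)\<close>, and \<open>k\<close> times the harmonic series equals \<open>T\<^sub>m(a) + T\<^sub>m(a + 1) + \<dots> + T\<^sub>m(a + k - 1)\<close>
  (\<open>harmonic_pole_series_sums\<close>).

  For \<open>b \<noteq> 0\<close> the identity \<open>1 / (n\<^sup>m (n + b)) = (1 / n\<^sup>m - 1 / (n\<^bsup>m - 1\<^esup> (n + b))) / b\<close> gives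
  \<open>T\<^sub>m(b) = (\<zeta>(m) - T\<^bsub>m - 1\<^esub>(b)) / b\<close>, a recursion that ends in the digamma series
  \<open>T\<^sub>1(b) = H\<^sub>b / b\<close>; this is the closed form \<open>pole_series_closed_form\<close>. The
  summation formula evaluates in this way only the summands \<open>b = a + i\<close> with \<open>1 \<le> i < k\<close>; it keeps
  \<open>T\<^sub>m(a)\<close> as a series and so remains valid for \<open>a = 0\<close>. The functional equation \<open>H\<^bsub>a + i\<^esub> = H\<^sub>a + \<Sum>\<^bsub>j \<le> i\<^esub> 1 / (a + j)\<close> then
  turns the shifted harmonic numbers into parametric ones.

  The integral is computed by expanding the polylogarithm and integrating each term
  \<open>x\<^bsup>a + n - 1\<^esup> / n\<^sup>m\<close> over the unit interval. The exchange is dominated because the integrals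
  of the absolute values are the terms of \<open>T\<^sub>m(Re a)\<close>. Integrability at \<open>0\<close> is decided by the
  leading term \<open>x\<^sup>a\<close> of the integrand, which gives the condition \<open>Re a > -1\<close>.
\<close>

section \<open>The pole series\<close>

definition pole_term :: "nat \<Rightarrow> complex \<Rightarrow> nat \<Rightarrow> complex" where
  "pole_term m b n = 1 / (of_nat (Suc n) ^ m * (of_nat (Suc n) + b))"

lemma add_of_nat_neq_0:
  assumes "b \<notin> \<int>\<^sub>\<le>\<^sub>0 - {0}" and "n \<ge> 1"
  shows "of_nat n + b \<noteq> (0 :: complex)"
proof
  assume "of_nat n + b = 0"
  hence "b = - of_nat n" by (simp add: add_eq_0_iff)
  with assms show False by auto
qed

lemma add_of_nat_notin_neg_Ints:
  assumes "b \<notin> \<int>\<^sub>\<le>\<^sub>0 - {0}"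
  shows "b + of_nat i \<notin> \<int>\<^sub>\<le>\<^sub>0 - ({0} :: complex set)"
proof
  assume "b + of_nat i \<in> \<int>\<^sub>\<le>\<^sub>0 - {0}"
  then obtain n where n: "b + of_nat i = - of_nat n" "n \<noteq> 0"
    by (auto elim!: nonpos_Ints_cases')
  have "of_nat (n + i) + b = (b + of_nat i) + of_nat n" by simp
  also have "\<dots> = 0" by (simp only: n(1) left_minus)
  finally have "of_nat (n + i) + b = 0" .
  with add_of_nat_neq_0[OF assms, of "n + i"] n(2) show False by simp
qed

text \<open>
  Once \<open>n \<ge> 2 |b|\<close>, the factor \<open>n + b\<close> has modulus at least \<open>n / 2\<close>, so the terms are
  dominated by \<open>2 / n\<^sup>2\<close>.
\<close>

lemma summable_norm_pole_term:
  assumes "m \<ge> 1"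
  shows "summable (\<lambda>n. norm (pole_term m b n))"
proof (rule summable_comparison_test_ev)
  have "summable (\<lambda>n. 1 / real n ^ 2)"
    using inverse_power_summable[of 2, where 'a=real] by (simp add: field_simps)
  hence "summable (\<lambda>n. 1 / real (Suc n) ^ 2)" by (subst summable_Suc_iff)
  thus "summable (\<lambda>n. 2 * (1 / real (Suc n) ^ 2))" by (rule summable_mult)
  show "\<forall>\<^sub>F n in sequentially. norm (norm (pole_term m b n)) \<le> 2 * (1 / real (Suc n) ^ 2)"
    using eventually_ge_at_top[of "nat \<lceil>2 * norm b\<rceil>"]
  proof eventually_elim
    case (elim n)
    define N where "N = real (Suc n)"
    have N: "N \<ge> 1" "N \<ge> 2 * norm b" using elim by (auto simp: N_def)
    have "norm (of_nat (Suc n) :: complex) = N" by (simp only: N_def norm_of_nat)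
    hence "norm (of_nat (Suc n) + b) \<ge> N - norm b"
      using norm_diff_ineq[of "of_nat (Suc n)" b] by simp
    hence shift: "norm (of_nat (Suc n) + b) \<ge> N / 2" using N by simp
    have pow: "N \<le> N ^ m" using N assms by (simp add: self_le_power)
    have "N * (N / 2) \<le> N ^ m * norm (of_nat (Suc n) + b)"
      using N by (intro mult_mono pow shift) auto
    hence "1 / (N ^ m * norm (of_nat (Suc n) + b)) \<le> 1 / (N * (N / 2))"
      using N shift by (intro divide_left_mono mult_pos_pos zero_less_power) auto
    thus ?case using N
      by (simp add: pole_term_def norm_divide norm_mult norm_power power2_eq_square N_def
          del: of_nat_Suc)
  qed
qed

lemma summable_pole_term: "m \<ge> 1 \<Longrightarrow> summable (pole_term m b)"
  using summable_norm_pole_term by (rule summable_norm_cancel)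

lemma zeta_of_nat_sums:
  assumes "m \<ge> 2"
  shows "(\<lambda>n. 1 / of_nat (Suc n) ^ m) sums zeta (of_nat m)"
proof -
  have eq: "of_nat (Suc n) powr of_nat m = (of_nat (Suc n) ^ m :: complex)" for n
    by (subst powr_nat') (auto simp del: of_nat_Suc)
  have "summable (\<lambda>n. inverse (of_nat n ^ m :: complex))"
    using assms by (rule inverse_power_summable)
  hence "summable (\<lambda>n. inverse (of_nat (Suc n) ^ m :: complex))" by (subst summable_Suc_iff)
  thus ?thesis unfolding zeta_def eq by (simp add: field_simps summable_sums del: of_nat_Suc)
qed

section \<open>Closed form of the pole series\<close>

lemma pole_series_1:
  assumes "b \<notin> \<int>\<^sub>\<le>\<^sub>0"
  shows "suminf (pole_term 1 b) = shifted_harm b / b"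
proof -
  have b: "b \<notin> \<int>\<^sub>\<le>\<^sub>0 - {0}" "b \<noteq> 0" using assms by auto
  have "1 + b \<noteq> 0" using add_of_nat_neq_0[OF b(1), of 1] by simp
  hence "(\<lambda>n. inverse (of_nat (Suc n)) - inverse (b + 1 + of_nat n)) sums shifted_harm b"
    using summable_Digamma[of "b + 1"]
    by (simp add: shifted_harm_def Digamma_def summable_sums add.commute)
  hence "(\<lambda>n. (inverse (of_nat (Suc n)) - inverse (b + 1 + of_nat n)) / b) sums (shifted_harm b / b)"
    by (rule sums_divide)
  moreover have "(inverse (of_nat (Suc n)) - inverse (b + 1 + of_nat n)) / b = pole_term 1 b n" for n
  proof -
    have shift: "b + 1 + of_nat n = of_nat (Suc n) + b" by simp
    have "of_nat (Suc n) + b \<noteq> 0" using add_of_nat_neq_0[OF b(1), of "Suc n"] by simp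
    moreover have "of_nat (Suc n) \<noteq> (0 :: complex)" by (simp del: of_nat_Suc)
    ultimately show ?thesis unfolding shift using b(2)
      by (simp add: pole_term_def divide_simps del: of_nat_Suc)
  qed
  ultimately show ?thesis by (simp add: sums_iff)
qed

text \<open>
  Termwise, \<open>1 / (n\<^bsup>m + 1\<^esup> (n + b)) = (1 / n\<^bsup>m + 1\<^esup> - 1 / (n\<^sup>m (n + b))) / b\<close>. The zeta series
  converges since its exponent is at least 2, which is why the recursion has to start at \<open>m = 1\<close>.
\<close>

lemma pole_series_Suc:
  assumes "m \<ge> 1" and "b \<notin> \<int>\<^sub>\<le>\<^sub>0"
  shows "suminf (pole_term (Suc m) b) = (zeta (of_nat (Suc m)) - suminf (pole_term m b)) / b"
proof -
  have b: "b \<notin> \<int>\<^sub>\<le>\<^sub>0 - {0}" "b \<noteq> 0" using assms by auto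
  have "(\<lambda>n. (1 / of_nat (Suc n) ^ Suc m - pole_term m b n) / b) sums
          ((zeta (of_nat (Suc m)) - suminf (pole_term m b)) / b)"
    using assms by (intro sums_divide sums_diff zeta_of_nat_sums summable_sums summable_pole_term) auto
  moreover have "(1 / of_nat (Suc n) ^ Suc m - pole_term m b n) / b = pole_term (Suc m) b n" for n
  proof -
    have "of_nat (Suc n) + b \<noteq> 0" using add_of_nat_neq_0[OF b(1), of "Suc n"] by simp
    moreover have "of_nat (Suc n) \<noteq> (0 :: complex)" by (simp del: of_nat_Suc)
    ultimately show ?thesis using b(2)
      by (simp add: pole_term_def divide_simps del: of_nat_Suc)
  qed
  ultimately show ?thesis by (simp add: sums_iff)
qed

lemma pole_series_closed_form:
  assumes "m \<ge> 1" and "b \<notin> \<int>\<^sub>\<le>\<^sub>0"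
  shows "suminf (pole_term m b) =
           (\<Sum>l=1..m-1. (-1) ^ (l-1) * (zeta (of_nat (m + 1 - l)) / b ^ l))
           + (-1) ^ (m-1) * (shifted_harm b / b ^ m)"
  using assms(1)
proof (induction m rule: dec_induct)
  case base
  show ?case using pole_series_1[OF assms(2)] by simp
next
  case (step m)
  have b: "b \<noteq> 0" using assms(2) by auto
  obtain p where p: "m = Suc p" using step.hyps by (cases m) auto
  \<comment> \<open>The new zeta value is the term \<open>l = 1\<close>; the old ones move up by one index.\<close>
  have "(\<Sum>l=1..m. (-1) ^ (l-1) * (zeta (of_nat (Suc m + 1 - l)) / b ^ l)) =
          zeta (of_nat (Suc m)) / b
          + (\<Sum>l=1..p. (-1) ^ l * (zeta (of_nat (m + 1 - l)) / b ^ Suc l))"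
    unfolding p by (subst sum.atLeast_Suc_atMost, simp,
        subst sum.shift_bounds_cl_Suc_ivl) simp
  also have "(\<Sum>l=1..p. (-1) ^ l * (zeta (of_nat (m + 1 - l)) / b ^ Suc l)) =
               - (\<Sum>l=1..p. (-1) ^ (l-1) * (zeta (of_nat (m + 1 - l)) / b ^ l)) / b"
    unfolding sum_divide_distrib sum_negf[symmetric]
  proof (intro sum.cong refl)
    fix l assume "l \<in> {1..p}"
    then obtain q where "l = Suc q" by (cases l) auto
    thus "(-1) ^ l * (zeta (of_nat (m + 1 - l)) / b ^ Suc l) =
            - ((-1) ^ (l-1) * (zeta (of_nat (m + 1 - l)) / b ^ l)) / b"
      by simp
  qed
  finally have shift: "(\<Sum>l=1..m. (-1) ^ (l-1) * (zeta (of_nat (Suc m + 1 - l)) / b ^ l)) =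
      zeta (of_nat (Suc m)) / b
      - (\<Sum>l=1..p. (-1) ^ (l-1) * (zeta (of_nat (m + 1 - l)) / b ^ l)) / b"
    by simp
  have "suminf (pole_term (Suc m) b) = (zeta (of_nat (Suc m)) - suminf (pole_term m b)) / b"
    using step.hyps assms(2) by (intro pole_series_Suc) auto
  also have "\<dots> = (\<Sum>l=1..m. (-1) ^ (l-1) * (zeta (of_nat (Suc m + 1 - l)) / b ^ l))
                   + (-1) ^ m * (shifted_harm b / b ^ Suc m)"
    unfolding step.IH shift using b p by (simp add: field_simps)
  finally show ?case by simp
qed

section \<open>Series of generalized harmonic numbers\<close>

lemma gen_harm_Suc: "gen_harm m (Suc n) = gen_harm m n + 1 / of_nat (Suc n) ^ m"
  by (simp add: gen_harm_def)

lemma norm_gen_harm_le_harm: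
  assumes "m \<ge> 1"
  shows "norm (gen_harm m n) \<le> harm n"
  unfolding gen_harm_def harm_def
proof (rule sum_norm_le)
  fix j assume j: "j \<in> {1..n}"
  have "real j \<le> real j ^ m" using j assms by (intro self_le_power) auto
  thus "norm (1 / of_nat j ^ m :: complex) \<le> inverse (real j)"
    using j by (simp add: norm_divide norm_power divide_simps)
qed

text \<open>
  The worst case is \<open>m = 1\<close>, where the harmonic numbers still grow only like \<open>ln n\<close>.
\<close>

lemma gen_harm_over_n_tendsto_0:
  assumes "m \<ge> 1"
  shows "(\<lambda>n. gen_harm m n / of_nat n) \<longlonglongrightarrow> 0"
proof (rule Lim_null_comparison)
  have "(\<lambda>n. (harm n - ln (real n)) * (1 / real n) + ln (real n) / real n) \<longlonglongrightarrow>
          euler_mascheroni * 0 + 0"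
    by (intro tendsto_intros euler_mascheroni_LIMSEQ lim_1_over_n)
  moreover have "(harm n - ln (real n)) * (1 / real n) + ln (real n) / real n = harm n / real n" for n
    by (simp add: diff_divide_distrib)
  ultimately show "(\<lambda>n. harm n / real n) \<longlonglongrightarrow> 0" by simp
  show "\<forall>\<^sub>F n in sequentially. norm (gen_harm m n / of_nat n) \<le> harm n / real n"
    using norm_gen_harm_le_harm[OF assms]
    by (intro always_eventually allI) (simp add: norm_divide divide_right_mono)
qed

lemma gen_harm_boundary_tendsto_0:
  assumes "m \<ge> 1"
  shows "(\<lambda>n. gen_harm m n / (of_nat (Suc n) + b)) \<longlonglongrightarrow> 0"
proof -
  have "(\<lambda>n. (1 + b) * (1 / of_nat n)) \<longlonglongrightarrow> (1 + b) * 0"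
    by (intro tendsto_intros lim_1_over_n)
  hence "(\<lambda>n. (gen_harm m n / of_nat n) / (1 + (1 + b) * (1 / of_nat n))) \<longlonglongrightarrow> 0 / (1 + (1 + b) * 0)"
    by (intro tendsto_intros gen_harm_over_n_tendsto_0 assms) auto
  hence "(\<lambda>n. (gen_harm m n / of_nat n) / (1 + (1 + b) * (1 / of_nat n))) \<longlonglongrightarrow> 0" by simp
  moreover have "\<forall>\<^sub>F n in sequentially. (gen_harm m n / of_nat n) / (1 + (1 + b) * (1 / of_nat n)) =
                    gen_harm m n / (of_nat (Suc n) + b)"
    using eventually_gt_at_top[of 0]
  proof eventually_elim
    case (elim n)
    have "of_nat (Suc n) + b = of_nat n * (1 + (1 + b) * (1 / of_nat n))"
      using elim by (simp add: field_simps)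
    thus ?case by (simp add: divide_divide_eq_left)
  qed
  ultimately show ?thesis by (rule Lim_transform_eventually)
qed

text \<open>
  Summation by parts; the boundary term at \<open>N\<close> is \<open>H\<^sub>N\<^sup>(\<^sup>m\<^sup>) / (N + 1 + b)\<close>.
\<close>

lemma harmonic_unit_step_sums:
  assumes "m \<ge> 1"
  shows "(\<lambda>n. gen_harm m (Suc n) * (1 / (of_nat (Suc n) + b) - 1 / (of_nat (Suc (Suc n)) + b)))
           sums suminf (pole_term m b)"
  unfolding sums_def
proof -
  have parts: "(\<Sum>n<N. gen_harm m (Suc n) * (1 / (of_nat (Suc n) + b) - 1 / (of_nat (Suc (Suc n)) + b)))
          = (\<Sum>n<N. pole_term m b n) - gen_harm m N / (of_nat (Suc N) + b)" for N
  proof (induction N)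
    case 0
    show ?case by (simp add: gen_harm_def)
  next
    case (Suc N)
    define u where "u = 1 / (of_nat (Suc N) + b)"
    have "pole_term m b N = (1 / of_nat (Suc N) ^ m) * u" by (simp add: pole_term_def u_def)
    thus ?case using Suc.IH unfolding sum.lessThan_Suc gen_harm_Suc[of m N]
      by (simp add: u_def[symmetric] algebra_simps divide_inverse del: of_nat_Suc)
        (simp add: u_def divide_inverse algebra_simps)
  qed
  have "(\<lambda>N. (\<Sum>n<N. pole_term m b n) - gen_harm m N / (of_nat (Suc N) + b)) \<longlonglongrightarrow>
          suminf (pole_term m b) - 0"
    by (intro tendsto_diff summable_LIMSEQ summable_pole_term gen_harm_boundary_tendsto_0 assms)
  thus "(\<lambda>N. \<Sum>n<N. gen_harm m (Suc n) * (1 / (of_nat (Suc n) + b) - 1 / (of_nat (Suc (Suc n)) + b)))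
          \<longlonglongrightarrow> suminf (pole_term m b)"
    unfolding parts by simp
qed

lemma harmonic_pole_series_sums:
  assumes "m \<ge> 1" and "k \<ge> 1" and "a \<notin> \<int>\<^sub>\<le>\<^sub>0 - {0}"
  shows "(\<lambda>n. gen_harm m (Suc n) / ((of_nat (Suc n) + a) * (of_nat (Suc n) + a + of_nat k))) sums
           (1 / of_nat k * (\<Sum>i<k. suminf (pole_term m (a + of_nat i))))"
proof -
  let ?r = "\<lambda>n i. 1 / (of_nat (Suc n) + a + of_nat i)"
  have "(\<lambda>n. 1 / of_nat k * (\<Sum>i<k. gen_harm m (Suc n) *
           (1 / (of_nat (Suc n) + (a + of_nat i)) - 1 / (of_nat (Suc (Suc n)) + (a + of_nat i)))))
         sums (1 / of_nat k * (\<Sum>i<k. suminf (pole_term m (a + of_nat i))))"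
    by (intro sums_mult sums_sum harmonic_unit_step_sums assms)
  moreover have "1 / of_nat k * (\<Sum>i<k. gen_harm m (Suc n) *
           (1 / (of_nat (Suc n) + (a + of_nat i)) - 1 / (of_nat (Suc (Suc n)) + (a + of_nat i)))) =
         gen_harm m (Suc n) / ((of_nat (Suc n) + a) * (of_nat (Suc n) + a + of_nat k))" for n
  proof -
    have nz: "of_nat (Suc n) + a \<noteq> 0" "of_nat (Suc n) + a + of_nat k \<noteq> 0"
      using add_of_nat_neq_0[OF assms(3), of "Suc n"] add_of_nat_neq_0[OF assms(3), of "Suc n + k"]
      by (simp_all add: add_ac)
    have "(\<Sum>i<k. gen_harm m (Suc n) *
            (1 / (of_nat (Suc n) + (a + of_nat i)) - 1 / (of_nat (Suc (Suc n)) + (a + of_nat i)))) =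
          gen_harm m (Suc n) * (\<Sum>i<k. ?r n i - ?r n (Suc i))"
      by (simp add: sum_distrib_left add_ac)
    also have "(\<Sum>i<k. ?r n i - ?r n (Suc i)) = ?r n 0 - ?r n k"
      by (rule sum_lessThan_telescope')
    also have "\<dots> = of_nat k / ((of_nat (Suc n) + a) * (of_nat (Suc n) + a + of_nat k))"
      using nz by (simp add: divide_simps)
    finally show ?thesis using assms(2) by simp
  qed
  ultimately show ?thesis by simp
qed

lemma shifted_harm_add_of_nat:
  assumes "a \<notin> \<int>\<^sub>\<le>\<^sub>0 - {0}"
  shows "shifted_harm (a + of_nat i) = shifted_harm a + param_harm 1 i a"
proof (induction i)
  case 0
  show ?case by (simp add: param_harm_def)
next
  case (Suc i)
  have "of_nat (Suc i) + a \<noteq> 0" using add_of_nat_neq_0[OF assms, of "Suc i"] by simp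
  hence "Digamma (of_nat (Suc i) + a + 1) = Digamma (of_nat (Suc i) + a) + 1 / (of_nat (Suc i) + a)"
    by (rule Digamma_plus1)
  hence "shifted_harm (a + of_nat (Suc i)) = shifted_harm (a + of_nat i) + 1 / (of_nat (Suc i) + a)"
    by (simp add: shifted_harm_def add_ac)
  thus ?case using Suc.IH by (simp add: param_harm_def)
qed

lemma sum_pole_series:
  assumes "m \<ge> 1" and "k \<ge> 1" and "a \<notin> \<int>\<^sub>\<le>\<^sub>0 - {0}"
  shows "(\<Sum>i<k. suminf (pole_term m (a + of_nat i))) =
           suminf (pole_term m a)
           + (\<Sum>j=1..m-1. (-1) ^ (j-1) * zeta (of_nat (m + 1 - j)) * param_harm j (k-1) a)
           + (-1) ^ (m-1) * shifted_harm a * param_harm m (k-1) a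
           + (-1) ^ (m-1) * (\<Sum>i=1..k-1. param_harm 1 i a / (of_nat i + a) ^ m)"
proof -
  obtain p where p: "k = Suc p" using assms(2) by (cases k) auto
  let ?Z = "\<lambda>i. \<Sum>l=1..m-1. (-1) ^ (l-1) * (zeta (of_nat (m + 1 - l)) / (of_nat i + a) ^ l)"
  have closed: "suminf (pole_term m (a + of_nat i)) =
                  ?Z i + (-1) ^ (m-1) * ((shifted_harm a + param_harm 1 i a) / (of_nat i + a) ^ m)"
    if "i \<in> {1..p}" for i
  proof -
    have "of_nat i + a \<noteq> 0" using add_of_nat_neq_0[OF assms(3), of i] that by simp
    hence "a + of_nat i \<notin> \<int>\<^sub>\<le>\<^sub>0"
      using add_of_nat_notin_neg_Ints[OF assms(3), of i] by (auto simp: add.commute)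
    from pole_series_closed_form[OF assms(1) this] show ?thesis
      by (simp add: shifted_harm_add_of_nat[OF assms(3)] add.commute)
  qed
  have zetas: "(\<Sum>i=1..p. ?Z i) =
      (\<Sum>j=1..m-1. (-1) ^ (j-1) * zeta (of_nat (m + 1 - j)) * param_harm j p a)"
    by (subst sum.swap) (simp add: param_harm_def sum_distrib_left mult.assoc)
  have "(\<Sum>i<k. suminf (pole_term m (a + of_nat i))) =
          suminf (pole_term m a) + (\<Sum>i=1..p. suminf (pole_term m (a + of_nat i)))"
    unfolding p sum.lessThan_Suc_shift
    by (simp add: sum.atLeast1_atMost_eq)
  also have "(\<Sum>i=1..p. suminf (pole_term m (a + of_nat i))) =
      (\<Sum>i=1..p. ?Z i + (-1) ^ (m-1) * ((shifted_harm a + param_harm 1 i a) / (of_nat i + a) ^ m))"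
    by (intro sum.cong refl closed)
  also have "\<dots> = (\<Sum>i=1..p. ?Z i) + (-1) ^ (m-1) * shifted_harm a * param_harm m p a
           + (-1) ^ (m-1) * (\<Sum>i=1..p. param_harm 1 i a / (of_nat i + a) ^ m)"
    by (simp add: sum.distrib sum_distrib_left param_harm_def[of m] add_divide_distrib
        distrib_left mult.assoc add.assoc)
  finally show ?thesis unfolding zetas p by simp
qed

section \<open>The integral of the polylogarithm\<close>

lemma integrable_powr_unit_interval:
  fixes r :: real
  assumes "r > 0"
  shows "set_integrable lborel {0<..<1} (\<lambda>x. x powr (r - 1))"
    and "(LINT x:{0<..<1}|lborel. x powr (r - 1)) = 1 / r"
proof -
  have "\<forall>\<^sub>F x in at_right (0::real). 0 \<le> x"
    using eventually_at_right_less[of 0] by eventually_elim simp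
  hence lim0: "(((\<lambda>x. x powr r / r) \<circ> real_of_ereal) \<longlongrightarrow> 0) (at_right (0::ereal))"
    unfolding zero_ereal_def
    using assms by (auto simp: ereal_tendsto_simps intro!: tendsto_eq_intros)
  have lim1: "(((\<lambda>x. x powr r / r) \<circ> real_of_ereal) \<longlongrightarrow> 1 / r) (at_left (1::ereal))"
    unfolding one_ereal_def
    using assms by (auto simp: ereal_tendsto_simps intro!: tendsto_eq_intros)
  have "set_integrable lborel (einterval 0 1) (\<lambda>x. x powr (r - 1))"
       "(LBINT x=(0::ereal)..1. x powr (r - 1)) = 1 / r - 0"
    using assms
    by (intro interval_integral_FTC_nonneg[where F = "\<lambda>x. x powr r / r", OF _ _ _ _ lim0 lim1];
        auto intro!: derivative_eq_intros continuous_intros)+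
  thus "set_integrable lborel {0<..<1} (\<lambda>x. x powr (r - 1))"
    and "(LINT x:{0<..<1}|lborel. x powr (r - 1)) = 1 / r"
    by (simp_all add: interval_lebesgue_integral_def einterval_eq zero_ereal_def one_ereal_def)
qed

text \<open>
  The function \<open>1 / x\<close> dominates \<open>x\<^bsup>s - 1\<^esup>\<close> for every \<open>s > 0\<close>, while the integral of the
  latter is \<open>1 / s\<close>, which is unbounded as \<open>s\<close> tends to \<open>0\<close>.
\<close>

lemma not_integrable_inverse_unit_interval:
  "\<not> set_integrable lborel {0<..<1} (\<lambda>x::real. 1 / x)"
proof
  assume int: "set_integrable lborel {0<..<1} (\<lambda>x::real. 1 / x)"
  define I where "I = (LINT x:{0<..<1}|lborel. 1 / x :: real)"
  have bound: "1 / s \<le> I" if "s > 0" for s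
  proof -
    have "(LINT x:{0<..<1}|lborel. x powr (s - 1)) \<le> I"
      unfolding I_def
    proof (rule set_integral_mono[OF integrable_powr_unit_interval(1)[OF that] int])
      fix x :: real assume x: "x \<in> {0<..<1}"
      hence "x powr (s - 1) \<le> x powr (-1)" using that by (intro powr_mono') auto
      thus "x powr (s - 1) \<le> 1 / x" using x by (simp add: powr_minus divide_inverse)
    qed
    thus ?thesis using integrable_powr_unit_interval(2)[OF that] by simp
  qed
  from bound[of 1] have "I \<ge> 1" by simp
  with bound[of "1 / (I + 1)"] show False by simp
qed

lemma norm_of_real_powr:
  "x > 0 \<Longrightarrow> norm (of_real x powr c :: complex) = x powr Re c"
  by (simp add: norm_powr_real_powr)

lemma complex_powr_unit_interval:
  fixes c :: complex
  assumes "Re c > 0"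
  shows "set_integrable lborel {0<..<1} (\<lambda>x. of_real x powr (c - 1))"
    and "(LINT x:{0<..<1}|lborel. of_real x powr (c - 1)) = 1 / c"
proof -
  show int: "set_integrable lborel {0<..<1} (\<lambda>x. of_real x powr (c - 1))"
  proof (rule set_integrable_bound[OF integrable_powr_unit_interval(1)[OF assms]])
    have "continuous_on {0<..<1} (\<lambda>x. of_real x powr (c - 1))"
      by (intro continuous_intros) auto
    thus "set_borel_measurable lborel {0<..<1} (\<lambda>x. of_real x powr (c - 1))"
      by (simp add: set_borel_measurable_def borel_measurable_continuous_on_indicator)
    show "AE x in lborel. x \<in> {0<..<1} \<longrightarrow>
            norm (of_real x powr (c - 1)) \<le> norm (x powr (Re c - 1))"
      by (simp add: norm_of_real_powr)
  qed
  have c: "c \<noteq> 0" using assms by auto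
  have lim0: "(((\<lambda>x. of_real x powr c / c) \<circ> real_of_ereal) \<longlongrightarrow> 0) (at_right (0::ereal))"
  proof -
    have "\<forall>\<^sub>F x in at_right (0::real). 0 \<le> x"
      using eventually_at_right_less[of 0] by eventually_elim simp
    hence "((\<lambda>x. x powr Re c / norm c) \<longlongrightarrow> 0) (at_right (0::real))"
      using assms by (auto intro!: tendsto_eq_intros)
    moreover have "\<forall>\<^sub>F x in at_right (0::real). norm (of_real x powr c / c) \<le> x powr Re c / norm c"
      using eventually_at_right_less[of 0]
      by eventually_elim (simp add: norm_divide norm_of_real_powr)
    ultimately have "((\<lambda>x. of_real x powr c / c) \<longlongrightarrow> 0) (at_right (0::real))"
      by (rule Lim_null_comparison[rotated])
    thus ?thesis unfolding zero_ereal_def by (simp add: ereal_tendsto_simps)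
  qed
  have lim1: "(((\<lambda>x. of_real x powr c / c) \<circ> real_of_ereal) \<longlongrightarrow> 1 / c) (at_left (1::ereal))"
  proof -
    have "isCont (\<lambda>x::real. of_real x powr c / c) 1"
      using c by (intro continuous_intros) auto
    hence "((\<lambda>x::real. of_real x powr c / c) \<longlongrightarrow> of_real 1 powr c / c) (at_left 1)"
      unfolding isCont_def by (rule tendsto_within_subset) auto
    thus ?thesis unfolding one_ereal_def by (simp add: ereal_tendsto_simps)
  qed
  have ivl: "einterval 0 1 = {0<..<1::real}" by (auto simp: einterval_def)
  have "(LBINT x=(0::ereal)..1. of_real x powr (c - 1)) = 1 / c - 0"
  proof (rule interval_integral_FTC_integrable[where F = "\<lambda>x. of_real x powr c / c", OF _ _ _ _ lim0 lim1])
    fix x :: real assume "0 < ereal x" "ereal x < 1"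
    hence x: "x > 0" by simp
    have "((\<lambda>z. z powr c / c) has_field_derivative of_real x powr (c - 1)) (at (of_real x))"
      using x c by (auto intro!: derivative_eq_intros)
    thus "((\<lambda>x. of_real x powr c / c) has_vector_derivative of_real x powr (c - 1)) (at x)"
      by (rule has_vector_derivative_real_field)
    show "isCont (\<lambda>x. of_real x powr (c - 1)) x"
      using x by (intro continuous_intros) auto
  qed (use int ivl in auto)
  thus "(LINT x:{0<..<1}|lborel. of_real x powr (c - 1)) = 1 / c"
    by (simp add: interval_lebesgue_integral_def ivl)
qed

lemma summable_polylog:
  assumes "0 < x" "x < (1::real)"
  shows "summable (\<lambda>n. x ^ Suc n / of_nat (Suc n) ^ m)"
proof (rule summable_comparison_test')
  show "summable (\<lambda>n. x ^ n)" using assms by (intro summable_geometric) auto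
  show "norm (x ^ Suc n / of_nat (Suc n) ^ m) \<le> x ^ n" for n
  proof -
    have "1 \<le> real (Suc n) ^ m" by simp
    hence "x ^ Suc n / real (Suc n) ^ m \<le> x ^ Suc n / 1"
      using assms by (intro divide_left_mono) auto
    also have "\<dots> \<le> x ^ n" using assms by (simp add: mult_left_le_one_le)
    finally show ?thesis using assms by simp
  qed
qed

lemma polylog_ge:
  assumes "0 < x" "x < 1"
  shows "x \<le> polylog m x"
  using sum_le_suminf[OF summable_polylog[OF assms, of m], of "{0}"] assms
  by (simp add: polylog_def)

lemma polylog_integrand_sums:
  fixes a :: complex
  assumes "0 < x" "x < 1"
  shows "(\<lambda>n. of_real x powr (a + of_nat (Suc n) - 1) / of_nat (Suc n) ^ m) sums
           (of_real x powr (a - 1) * of_real (polylog m x))"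
proof -
  have "(\<lambda>n. x ^ Suc n / of_nat (Suc n) ^ m) sums polylog m x"
    unfolding polylog_def by (intro summable_sums summable_polylog assms)
  hence "(\<lambda>n. of_real x powr (a - 1) * complex_of_real (x ^ Suc n / of_nat (Suc n) ^ m)) sums
           (of_real x powr (a - 1) * of_real (polylog m x))"
    by (intro sums_mult sums_of_real)
  moreover have "of_real x powr (a - 1) * complex_of_real (x ^ Suc n / of_nat (Suc n) ^ m) =
          of_real x powr (a + of_nat (Suc n) - 1) / of_nat (Suc n) ^ m" for n
  proof -
    have "of_real x powr (a + of_nat (Suc n) - 1) =
            of_real x powr (a - 1) * (of_real x powr of_nat (Suc n) :: complex)"
      unfolding powr_add[symmetric] by (simp add: algebra_simps)
    also have "of_real x powr of_nat (Suc n) = (of_real x ^ Suc n :: complex)"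
      using assms by (subst powr_nat') auto
    finally show ?thesis by (simp del: of_nat_Suc)
  qed
  ultimately show ?thesis by (simp only:)
qed

text \<open>
  Term by term integration. The modulus of the \<open>n\<close>-th term has the form of the term itself with
  \<open>Re a\<close> in place of \<open>a\<close>, so the sum of the integrals of the moduli is again a pole series.
\<close>

lemma polylog_integral:
  fixes a :: complex
  assumes "m \<ge> 1" and "Re a > -1"
  shows "set_integrable lborel {0<..<1} (\<lambda>x. of_real x powr (a - 1) * of_real (polylog m x))"
    and "(LINT x:{0<..<1}|lborel. of_real x powr (a - 1) * of_real (polylog m x)) =
           suminf (pole_term m a)"
proof -
  define f :: "nat \<Rightarrow> real \<Rightarrow> complex" where
    "f n = (\<lambda>x. indicator {0<..<1} x *\<^sub>R
              (of_real x powr (a + of_nat (Suc n) - 1) / of_nat (Suc n) ^ m))"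
    for n
  have pos: "Re (a + of_nat (Suc n)) > 0" for n using assms(2) by simp
  have f_int: "integrable lborel (f n)" for n
    using set_integrable_divide[OF complex_powr_unit_interval(1)[OF pos[of n]], of "of_nat (Suc n) ^ m"]
    by (simp add: f_def set_integrable_def del: of_nat_Suc)
  have f_eq: "integral\<^sup>L lborel (f n) = pole_term m a n" for n
  proof -
    have "integral\<^sup>L lborel (f n) =
            (LINT x:{0<..<1}|lborel. of_real x powr (a + of_nat (Suc n) - 1) / of_nat (Suc n) ^ m)"
      by (simp only: f_def set_lebesgue_integral_def)
    also have "\<dots> = 1 / (a + of_nat (Suc n)) / of_nat (Suc n) ^ m"
      by (simp only: set_integral_divide_zero complex_powr_unit_interval(2)[OF pos])
    finally show ?thesis by (simp add: pole_term_def add.commute mult.commute del: of_nat_Suc)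
  qed
  have f_sums: "f' sums (indicator {0<..<1} x *\<^sub>R (of_real x powr (a - 1) * of_real (polylog m x)))"
    if "f' = (\<lambda>n. f n x)" for f' x
    unfolding that f_def using polylog_integrand_sums[of x a m]
    by (cases "x \<in> {0<..<1}") auto
  have f_norm: "norm (f n x) = indicator {0<..<1} x *\<^sub>R
                  (x powr (Re a + real (Suc n) - 1) / real (Suc n) ^ m)" for n x
    by (auto simp: f_def indicator_def norm_divide norm_power norm_of_real_powr simp del: of_nat_Suc)
  have norm_eq: "(LINT x|lborel. norm (f n x)) = norm (pole_term m (of_real (Re a)) n)" for n
  proof -
    have r: "Re a + real (Suc n) > 0" using assms(2) by simp
    have "(LINT x|lborel. norm (f n x)) = 1 / (Re a + real (Suc n)) / real (Suc n) ^ m"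
      unfolding f_norm set_lebesgue_integral_def[symmetric] set_integral_divide_zero
        integrable_powr_unit_interval(2)[OF r] by (rule refl)
    moreover have "norm (of_nat (Suc n) + of_real (Re a) :: complex) = Re a + real (Suc n)"
      using r by (metis add.commute abs_of_pos norm_of_real of_real_add of_real_of_nat_eq)
    ultimately show ?thesis
      by (simp add: pole_term_def norm_divide norm_mult norm_power mult.commute del: of_nat_Suc)
  qed
  have abs_sum: "AE x in lborel. summable (\<lambda>n. norm (f n x))"
  proof (rule AE_I2)
    fix x
    show "summable (\<lambda>n. norm (f n x))"
    proof (cases "x \<in> {0<..<1}")
      case True
      have "norm (f n x) = norm (of_real (x powr (Re a - 1) * (x ^ Suc n / of_nat (Suc n) ^ m)) :: real)" for n
      proof -
        have "x powr (Re a + real (Suc n) - 1) = x powr (Re a - 1) * x powr real (Suc n)"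
          unfolding powr_add[symmetric] by (simp add: algebra_simps)
        thus ?thesis using True by (simp add: f_norm powr_realpow abs_mult del: of_nat_Suc power_Suc)
      qed
      moreover have "summable (\<lambda>n. x powr (Re a - 1) * (x ^ Suc n / of_nat (Suc n) ^ m))"
        using True by (intro summable_mult summable_polylog) auto
      ultimately show ?thesis using True by (simp add: abs_mult del: of_nat_Suc power_Suc)
    qed (simp add: f_def)
  qed
  have int_sum: "summable (\<lambda>n. LINT x|lborel. norm (f n x))"
    unfolding norm_eq by (rule summable_norm_pole_term[OF assms(1)])
  have lim: "(\<Sum>n. f n x) = indicator {0<..<1} x *\<^sub>R (of_real x powr (a - 1) * of_real (polylog m x))" for x
    using f_sums[OF refl] by (simp add: sums_iff)
  show "set_integrable lborel {0<..<1} (\<lambda>x. of_real x powr (a - 1) * of_real (polylog m x))"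
    using integrable_suminf[OF f_int abs_sum int_sum] by (simp add: lim set_integrable_def)
  show "(LINT x:{0<..<1}|lborel. of_real x powr (a - 1) * of_real (polylog m x)) =
          suminf (pole_term m a)"
    using integral_suminf[OF f_int abs_sum int_sum] by (simp add: lim f_eq set_lebesgue_integral_def)
qed

text \<open>
  Since the polylogarithm is at least \<open>x\<close>, the modulus of the integrand is at least
  \<open>x\<^bsup>Re a\<^esup> \<ge> 1 / x\<close> when \<open>Re a \<le> -1\<close>.
\<close>

lemma polylog_integrand_not_integrable:
  fixes a :: complex
  assumes "Re a \<le> -1"
  shows "\<not> set_integrable lborel {0<..<1} (\<lambda>x. of_real x powr (a - 1) * of_real (polylog m x))"
proof
  assume int: "set_integrable lborel {0<..<1} (\<lambda>x. of_real x powr (a - 1) * of_real (polylog m x))"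
  have "set_integrable lborel {0<..<1} (\<lambda>x::real. 1 / x)"
  proof (rule set_integrable_bound[OF int])
    show "set_borel_measurable lborel {0<..<1} (\<lambda>x::real. 1 / x)"
      unfolding set_borel_measurable_def by measurable
    show "AE x in lborel. x \<in> {0<..<1} \<longrightarrow>
            norm (1 / x) \<le> norm (of_real x powr (a - 1) * of_real (polylog m x) :: complex)"
    proof (intro AE_I2 impI)
      fix x :: real assume x: "x \<in> {0<..<1}"
      have "1 / x = x powr (-2) * x" using x by (simp add: powr_minus field_simps power2_eq_square)
      also have "\<dots> \<le> x powr (Re a - 1) * polylog m x"
        using x assms polylog_ge[of x m] by (intro mult_mono powr_mono') auto
      also have "\<dots> = norm (of_real x powr (a - 1) * of_real (polylog m x) :: complex)"
        using x polylog_ge[of x m] by (simp add: norm_mult norm_of_real_powr)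
      finally show "norm (1 / x) \<le> norm (of_real x powr (a - 1) * of_real (polylog m x) :: complex)"
        using x by simp
    qed
  qed
  thus False using not_integrable_inverse_unit_interval by contradiction
qed

section \<open>The summation and integral formulas\<close>

theorem theorem3p2:
  fixes m k :: nat and a :: complex
  assumes "m \<ge> 1" and "k \<ge> 1" and "a \<notin> \<int>\<^sub>\<le>\<^sub>0 - {0}"
  shows
    "summable (\<lambda>n. 1 / (of_nat (Suc n) ^ m * (of_nat (Suc n) + a))) \<and>
     (\<lambda>n. gen_harm m (Suc n) / ((of_nat (Suc n) + a) * (of_nat (Suc n) + a + of_nat k))) sums
       (1 / of_nat k *
         ((\<Sum>n. 1 / (of_nat (Suc n) ^ m * (of_nat (Suc n) + a)))
          + (\<Sum>j=1..m-1. (-1) ^ (j-1) * zeta (of_nat (m + 1 - j)) * param_harm j (k-1) a)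
          + (-1) ^ (m-1) * shifted_harm a * param_harm m (k-1) a
          + (-1) ^ (m-1) * (\<Sum>i=1..k-1. param_harm 1 i a / (of_nat i + a) ^ m)))
     \<and>
     (a \<notin> \<int>\<^sub>\<le>\<^sub>0 \<longrightarrow>
       (interval_lebesgue_integrable lborel 0 1
          (\<lambda>x. of_real x powr (a - 1) * of_real (polylog m x)) \<longleftrightarrow> Re a > -1) \<and>
       (Re a > -1 \<longrightarrow>
          (LBINT x=0..1. of_real x powr (a - 1) * of_real (polylog m x))
            = (\<Sum>n. 1 / (of_nat (Suc n) ^ m * (of_nat (Suc n) + a)))) \<and>
       (\<Sum>n. 1 / (of_nat (Suc n) ^ m * (of_nat (Suc n) + a)))
         = (\<Sum>l=1..m-1. (-1) ^ (l-1) * (zeta (of_nat (m + 1 - l)) / a ^ l))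
           + (-1) ^ (m-1) * (shifted_harm a / a ^ m))"
proof -
  have ivl: "einterval 0 1 = {0<..<1::real}" by (auto simp: einterval_def)
  have term_eq: "(\<lambda>n. 1 / (of_nat (Suc n) ^ m * (of_nat (Suc n) + a))) = pole_term m a"
    by (simp add: fun_eq_iff pole_term_def)
  have series: "(\<lambda>n. gen_harm m (Suc n) / ((of_nat (Suc n) + a) * (of_nat (Suc n) + a + of_nat k))) sums
       (1 / of_nat k *
         (suminf (pole_term m a)
          + (\<Sum>j=1..m-1. (-1) ^ (j-1) * zeta (of_nat (m + 1 - j)) * param_harm j (k-1) a)
          + (-1) ^ (m-1) * shifted_harm a * param_harm m (k-1) a
          + (-1) ^ (m-1) * (\<Sum>i=1..k-1. param_harm 1 i a / (of_nat i + a) ^ m)))"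
    using harmonic_pole_series_sums[OF assms] unfolding sum_pole_series[OF assms] .
  have integrable: "set_integrable lborel {0<..<1}
      (\<lambda>x. of_real x powr (a - 1) * of_real (polylog m x)) \<longleftrightarrow> Re a > -1"
    using polylog_integral(1)[OF assms(1), of a] polylog_integrand_not_integrable[of a m]
    by (cases "Re a > -1") auto
  have order: "(0::ereal) \<le> 1" by simp
  show ?thesis
    unfolding term_eq interval_lebesgue_integral_def interval_lebesgue_integrable_def ivl
      if_P[OF order]
    by (intro conjI impI summable_pole_term series integrable polylog_integral(2)
        pole_series_closed_form assms(1))
qed

end
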